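(* Let $F:\mathbb{R}^n\rightrightarrows\mathbb{R}^n$ be a set-valued mapping and let $(\bar x,\bar y)\in\mathrm{gph}\,F$, with $\mathrm{gph}\,F$ locally closed around $(\bar x,\bar y)$. Then $F$ is strongly metrically subregular around $(\bar x,\bar y)$ if and only if the condition $$0\in D^\sharp F(\bar x,\bar y)(u)\ \Rightarrow\ u=0$$ holds, and in this case one has $$\mathrm{l\text{-}subreg}\,F(\bar x,\bar y)=\sup\{\|u\|\mid(u,v)\in\mathrm{gph}\,D^\sharp F(\bar x,\bar y),\ \|v\|\le1\}.$$
   Context: Norms are Euclidean. $\mathrm{gph}\,F=\{(x,y)\mid y\in F(x)\}$. For a set $A$ and $\bar z\in A$, the tangent cone $T_A(\bar z)$ is the set of all $w$ for which there are $t_k\downarrow0$, $w_k\to w$ with $\bar z+t_kw_k\in A$ for all $k$. The outer limiting tangent cone $T_A^\sharp(\bar z)$ is the set of all limits of sequences $w_k\in T_A(z_k)$ with $z_k\to\bar z$, $z_k\in A$ (the choice $z_k=\bar z$ is allowed). The outer limiting graphical derivative $D^\sharp F(\bar x,\bar y):\mathbb{R}^n\rightrightarrows\mathbb{R}^n$ is defined by $\mathrm{gph}\,D^\sharp F(\bar x,\bar y)=T^\sharp_{\mathrm{gph}\,F}(\bar x,\bar y)$. $F$ is metrically subregular at $(x,y)\in\mathrm{gph}\,F$ if there are $\kappa\ge0$ and a neighborhood $X$ of $x$ with $\mathrm{dist}(x',F^{-1}(y))\le\kappa\,\mathrm{dist}(y,F(x'))$ for all $x'\in X$; $\mathrm{subreg}\,F(x,y)$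 is the infimum of such $\kappa$ (over all neighborhoods $X$). $F$ is strongly metrically subregular at $(x,y)$ if, in addition, $F^{-1}(y)\cap X'=\{x\}$ for some neighborhood $X'$ of $x$. $F$ is strongly metrically subregular around $(\bar x,\bar y)$ if there is a neighborhood $W$ of $(\bar x,\bar y)$ such that $F$ is strongly metrically subregular at every point of $\mathrm{gph}\,F\cap W$ and $$\mathrm{l\text{-}subreg}\,F(\bar x,\bar y):=\limsup_{(x,y)\to(\bar x,\bar y),\,(x,y)\in\mathrm{gph}\,F}\mathrm{subreg}\,F(x,y)<\infty$$ (the point $(x,y)=(\bar x,\bar y)$ itself being allowed in the limsup). *)

theory Defs
  imports "HOL-Analysis.Analysis"
begin

text \<open>
  A set-valued mapping \<open>F\<close> from \<open>'a\<close> to \<open>'b\<close> is a function \<open>'a \<Rightarrow> 'b set\<close>; \<open>F x\<close> may be empty.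
  The library norm on \<open>real ^ 'n\<close> and on products is the Euclidean one.
\<close>

definition gph :: "('a \<Rightarrow> 'b set) \<Rightarrow> ('a \<times> 'b) set" where
  "gph F = {(x, y). y \<in> F x}"

definition set_inv :: "('a \<Rightarrow> 'b set) \<Rightarrow> 'b \<Rightarrow> 'a set" where
  "set_inv F y = {x. y \<in> F x}"

definition locally_closed_around :: "'a::topological_space set \<Rightarrow> 'a \<Rightarrow> bool" where
  "locally_closed_around A z \<longleftrightarrow> (\<exists>V. closed V \<and> z \<in> interior V \<and> closed (A \<inter> V))"

definition tangent_cone :: "'a::real_normed_vector set \<Rightarrow> 'a \<Rightarrow> 'a set" where
  "tangent_cone A z = {w. \<exists>(t :: nat \<Rightarrow> real) (w' :: nat \<Rightarrow> 'a).
     (\<forall>k. t k > 0) \<and> t \<longlonglongrightarrow> 0 \<and> w' \<longlonglongrightarrow> w \<and> (\<forall>k. z + t k *\<^sub>R w' k \<in> A)}"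

definition outer_limiting_tangent_cone :: "'a::real_normed_vector set \<Rightarrow> 'a \<Rightarrow> 'a set" where
  "outer_limiting_tangent_cone A z = {w. \<exists>(z' :: nat \<Rightarrow> 'a) (w' :: nat \<Rightarrow> 'a).
     (\<forall>k. z' k \<in> A) \<and> z' \<longlonglongrightarrow> z \<and> (\<forall>k. w' k \<in> tangent_cone A (z' k)) \<and> w' \<longlonglongrightarrow> w}"

definition outer_limiting_graphical_derivative ::
  "('a::real_normed_vector \<Rightarrow> 'b::real_normed_vector set) \<Rightarrow> 'a \<Rightarrow> 'b \<Rightarrow> 'a \<Rightarrow> 'b set" where
  "outer_limiting_graphical_derivative F x y u =
     {v. (u, v) \<in> outer_limiting_tangent_cone (gph F) (x, y)}"

text \<open>
  The distance to the empty set is \<open>\<infinity>\<close>; the library's \<^const>\<open>infdist\<close> would return \<open>0\<close> there.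
\<close>

definition edist_set :: "'a::metric_space \<Rightarrow> 'a set \<Rightarrow> ereal" where
  "edist_set x S = (INF s\<in>S. ereal (dist x s))"

text \<open>
  In \<^typ>\<open>ereal\<close> one has \<open>0 * \<infinity> = 0\<close>. This concerns only \<open>\<kappa> = 0\<close> and affects neither the existence
  of a constant nor the infimum of all constants, since larger constants remain admissible.
\<close>

definition subreg_const ::
  "('a::metric_space \<Rightarrow> 'b::metric_space set) \<Rightarrow> 'a \<Rightarrow> 'b \<Rightarrow> real \<Rightarrow> bool" where
  "subreg_const F x y \<kappa> \<longleftrightarrow> \<kappa> \<ge> 0 \<and>
     (\<exists>X. open X \<and> x \<in> X \<and>
        (\<forall>x'\<in>X. edist_set x' (set_inv F y) \<le> ereal \<kappa> * edist_set y (F x')))"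

definition metrically_subregular ::
  "('a::metric_space \<Rightarrow> 'b::metric_space set) \<Rightarrow> 'a \<Rightarrow> 'b \<Rightarrow> bool" where
  "metrically_subregular F x y \<longleftrightarrow> (x, y) \<in> gph F \<and> (\<exists>\<kappa>. subreg_const F x y \<kappa>)"

text \<open>The value is \<open>\<infinity>\<close> if no constant exists.\<close>

definition subreg :: "('a::metric_space \<Rightarrow> 'b::metric_space set) \<Rightarrow> 'a \<Rightarrow> 'b \<Rightarrow> ereal" where
  "subreg F x y = (INF \<kappa>\<in>{\<kappa>. subreg_const F x y \<kappa>}. ereal \<kappa>)"

definition strongly_metrically_subregular ::
  "('a::metric_space \<Rightarrow> 'b::metric_space set) \<Rightarrow> 'a \<Rightarrow> 'b \<Rightarrow> bool" where
  "strongly_metrically_subregular F x y \<longleftrightarrow> metrically_subregular F x y \<and>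
     (\<exists>X'. open X' \<and> x \<in> X' \<and> set_inv F y \<inter> X' = {x})"

text \<open>
  The filter is \<^const>\<open>nhds\<close> rather than \<^const>\<open>at\<close>, so the reference point itself takes part in
  the upper limit.
\<close>

definition l_subreg :: "('a::metric_space \<Rightarrow> 'b::metric_space set) \<Rightarrow> 'a \<Rightarrow> 'b \<Rightarrow> ereal" where
  "l_subreg F x y =
     Limsup (inf (nhds (x, y)) (principal (gph F))) (\<lambda>(x', y'). subreg F x' y')"

definition strongly_metrically_subregular_around ::
  "('a::metric_space \<Rightarrow> 'b::metric_space set) \<Rightarrow> 'a \<Rightarrow> 'b \<Rightarrow> bool" where
  "strongly_metrically_subregular_around F x y \<longleftrightarrow>
     (\<exists>W. open W \<and> (x, y) \<in> W \<and>
        (\<forall>(x', y')\<in>gph F \<inter> W. strongly_metrically_subregular F x' y')) \<and>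
     l_subreg F x y < \<infinity>"

end

theory Submission
  imports Defs
begin

text \<open>
  At a graph point \<open>z = (x, y)\<close>, strong subregularity means an estimate
  \<open>norm (x' - x) \<le> M * norm (y' - y)\<close> for the graph points \<open>(x', y')\<close> with \<open>x'\<close> close to \<open>x\<close>. Up to an
  arbitrarily small change of \<open>M\<close> this is the infinitesimal estimate \<open>norm u \<le> M * norm v\<close> on the
  tangent cone at \<open>z\<close>: divide by the step length in one direction, and in the other direction normalise
  the first component of the violating differences and pass to a convergent subsequence. The same
  compactness argument along graph points \<open>z\<^sub>k\<close> tending to the reference point transfers the estimate
  between the outer limiting tangent cone and all nearby tangent cones, and both claims follow.
\<close>

section \<open>Homogeneity of the cones and membership of the origin\<close>

lemma tangent_cone_scaleR:
  assumes "w \<in> tangent_cone A z" "c > 0"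
  shows "c *\<^sub>R w \<in> tangent_cone A z"
proof -
  obtain t w' where t: "\<And>k. t k > 0" "t \<longlonglongrightarrow> 0" and w': "w' \<longlonglongrightarrow> w"
    and A: "\<And>k. z + t k *\<^sub>R w' k \<in> A"
    using assms(1) unfolding tangent_cone_def by blast
  \<comment> \<open>Shrinking the steps by \<open>c\<close> compensates for stretching the
    directions by \<open>c\<close>; the points of \<open>A\<close> stay the same.\<close>
  have "(\<lambda>k. t k / c) \<longlonglongrightarrow> 0"
    using tendsto_divide[OF t(2) tendsto_const[of c]] assms(2) by simp
  moreover have "(\<lambda>k. c *\<^sub>R w' k) \<longlonglongrightarrow> c *\<^sub>R w"
    using w' by (intro tendsto_intros)
  moreover have "\<forall>k. t k / c > 0" "\<forall>k. z + (t k / c) *\<^sub>R (c *\<^sub>R w' k) \<in> A"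
    using t(1) A assms(2) by simp_all
  ultimately show ?thesis
    unfolding tangent_cone_def
    by (intro CollectI exI[of _ "\<lambda>k. t k / c"] exI[of _ "\<lambda>k. c *\<^sub>R w' k"]) simp
qed

lemma outer_limiting_tangent_cone_scaleR:
  assumes "w \<in> outer_limiting_tangent_cone A z" "c > 0"
  shows "c *\<^sub>R w \<in> outer_limiting_tangent_cone A z"
proof -
  obtain z' w' where z': "\<forall>k. z' k \<in> A" "z' \<longlonglongrightarrow> z"
    and w': "\<And>k. w' k \<in> tangent_cone A (z' k)" "w' \<longlonglongrightarrow> w"
    using assms(1) unfolding outer_limiting_tangent_cone_def by blast
  have "\<forall>k. c *\<^sub>R w' k \<in> tangent_cone A (z' k)"
    using tangent_cone_scaleR w'(1) assms(2) by blast
  moreover have "(\<lambda>k. c *\<^sub>R w' k) \<longlonglongrightarrow> c *\<^sub>R w"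
    using w'(2) by (intro tendsto_intros)
  ultimately show ?thesis
    using z' unfolding outer_limiting_tangent_cone_def
    by (intro CollectI exI[of _ z'] exI[of _ "\<lambda>k. c *\<^sub>R w' k"]) simp
qed

lemma zero_in_tangent_cone:
  assumes "z \<in> A"
  shows "0 \<in> tangent_cone A z"
proof -
  have "(\<lambda>k. 1 / real (Suc k)) \<longlonglongrightarrow> 0"
    using LIMSEQ_inverse_real_of_nat by (simp add: inverse_eq_divide)
  then show ?thesis
    using assms unfolding tangent_cone_def
    by (intro CollectI exI[of _ "\<lambda>k. 1 / real (Suc k)"] exI[of _ "\<lambda>k. 0"]) simp
qed

lemma zero_in_outer_limiting_tangent_cone:
  assumes "z \<in> A"
  shows "0 \<in> outer_limiting_tangent_cone A z"
  using assms zero_in_tangent_cone[OF assms] unfolding outer_limiting_tangent_cone_def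
  by (intro CollectI exI[of _ "\<lambda>k. z"] exI[of _ "\<lambda>k. 0"]) simp

section \<open>Compactness of normalised violating directions\<close>

text \<open>After division by the norm of the first component, the second component is bounded by
  \<open>d k\<close>, hence bounded, so Bolzano-Weierstrass applies. A varying \<open>d\<close>
  covers both a fixed modulus and moduli tending to infinity, where \<open>d\<close> tends to
  0.\<close>

lemma normalized_convergent_subsequence:
  fixes w :: "nat \<Rightarrow> 'a::euclidean_space \<times> 'b::euclidean_space"
  assumes nz: "\<And>k. fst (w k) \<noteq> 0"
    and le: "\<And>k. norm (snd (w k)) \<le> d k * norm (fst (w k))"
    and d: "d \<longlonglongrightarrow> l"
  obtains r u v where "strict_mono r"
    "(\<lambda>k. (1 / norm (fst (w (r k)))) *\<^sub>R w (r k)) \<longlonglongrightarrow> (u, v)" "norm u = 1" "norm v \<le> l"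
proof -
  define w' where "w' k = (1 / norm (fst (w k))) *\<^sub>R w k" for k
  have n1: "norm (fst (w' k)) = 1" for k
    using nz[of k] by (simp add: w'_def)
  have n2: "norm (snd (w' k)) \<le> d k" for k
    using nz[of k] le[of k] by (simp add: w'_def field_simps)
  obtain B where B: "\<And>k. norm (d k) \<le> B"
    using d convergent_imp_Bseq[of d] unfolding convergent_def Bseq_def by blast
  have "norm (w' k) \<le> 1 + B" for k
    using norm_Pair_le[of "fst (w' k)" "snd (w' k)"] n1[of k] n2[of k] B[of k] by simp
  then have "bounded (range w')"
    unfolding bounded_iff by blast
  then obtain p r where r: "strict_mono r" and lim: "(w' \<circ> r) \<longlonglongrightarrow> p"
    using bounded_imp_convergent_subsequence by blast
  have "(\<lambda>k. norm (fst ((w' \<circ> r) k))) \<longlonglongrightarrow> norm (fst p)"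
    using lim by (intro tendsto_intros)
  then have "norm (fst p) = 1"
    using n1 by (simp add: LIMSEQ_const_iff)
  moreover have "norm (snd p) \<le> l"
  proof (rule LIMSEQ_le)
    show "(\<lambda>k. norm (snd ((w' \<circ> r) k))) \<longlonglongrightarrow> norm (snd p)"
      using lim by (intro tendsto_intros)
    show "(d \<circ> r) \<longlonglongrightarrow> l"
      using LIMSEQ_subseq_LIMSEQ[OF d r] .
  qed (use n2 in auto)
  ultimately show thesis
    using that[of r "fst p" "snd p"] r lim by (simp add: w'_def o_def)
qed

text \<open>Only \<open>x'\<close> has to be localised: a violating pair satisfies
  \<open>dist y' y < dist x' x / M'\<close>, so \<open>y'\<close> tends to \<open>y\<close> along
  with \<open>x'\<close> tending to \<open>x\<close>. The normalised differences then yield a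
  tangent direction with \<open>norm u = 1\<close> and \<open>norm v \<le> 1 / M'\<close>, and the
  gap between \<open>M\<close> and \<open>M'\<close> makes this contradict the tangent
  bound.\<close>

lemma tangent_bound_imp_local_bound:
  fixes A :: "('a::euclidean_space \<times> 'b::euclidean_space) set"
  assumes T: "\<And>u v. (u, v) \<in> tangent_cone A (x, y) \<Longrightarrow> norm u \<le> M * norm v"
    and M: "0 \<le> M" "M < M'"
  shows "\<exists>e>0. \<forall>x' y'. (x', y') \<in> A \<longrightarrow> dist x' x < e \<longrightarrow> dist x' x \<le> M' * dist y' y"
proof (rule ccontr)
  assume "\<not> ?thesis"
  then have neg: "\<exists>x' y'. (x', y') \<in> A \<and> dist x' x < e \<and> M' * dist y' y < dist x' x"
    if "e > 0" for e
    using that by (meson not_le)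
  have "\<exists>p. p \<in> A \<and> dist (fst p) x < 1 / real (Suc k) \<and>
      M' * dist (snd p) y < dist (fst p) x" for k
    using neg[of "1 / real (Suc k)"] by force
  then obtain p where p: "\<And>k. p k \<in> A" "\<And>k. dist (fst (p k)) x < 1 / real (Suc k)"
      "\<And>k. M' * dist (snd (p k)) y < dist (fst (p k)) x"
    by metis
  define w where "w k = p k - (x, y)" for k
  have M': "M' > 0" using M by simp
  have nz: "fst (w k) \<noteq> 0" for k
  proof
    assume "fst (w k) = 0"
    then show False
      using p(3)[of k] M' by (simp add: w_def mult_less_0_iff)
  qed
  have le: "norm (snd (w k)) \<le> 1 / M' * norm (fst (w k))" for k
    using p(3)[of k] M' by (simp add: w_def dist_norm field_simps)
  obtain r u v where r: "strict_mono r"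
    and lim: "(\<lambda>k. (1 / norm (fst (w (r k)))) *\<^sub>R w (r k)) \<longlonglongrightarrow> (u, v)"
    and uv: "norm u = 1" "norm v \<le> 1 / M'"
    using normalized_convergent_subsequence[where d = "\<lambda>_. 1 / M'", OF nz le tendsto_const] .
  have "(\<lambda>k. norm (fst (w k))) \<longlonglongrightarrow> 0"
  proof (rule Lim_null_comparison)
    show "\<forall>\<^sub>F k in sequentially. norm (norm (fst (w k))) \<le> inverse (real (Suc k))"
      using p(2) by (auto intro!: always_eventually less_imp_le
          simp: w_def dist_norm inverse_eq_divide)
  qed (rule LIMSEQ_inverse_real_of_nat)
  then have "(\<lambda>k. norm (fst (w (r k)))) \<longlonglongrightarrow> 0"
    using LIMSEQ_subseq_LIMSEQ[OF _ r] by (fastforce simp: o_def)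
  moreover have "\<forall>k. norm (fst (w (r k))) > 0"
    using nz by simp
  \<comment> \<open>The norm of the first component serves as step length, so it cancels the
    normalisation and gives back the violating point \<open>p (r k)\<close>.\<close>
  moreover have "\<forall>k. (x, y) + norm (fst (w (r k))) *\<^sub>R ((1 / norm (fst (w (r k)))) *\<^sub>R w (r k)) \<in> A"
    using nz p(1) by (simp add: w_def)
  ultimately have "(u, v) \<in> tangent_cone A (x, y)"
    using lim unfolding tangent_cone_def
    by (intro CollectI exI[of _ "\<lambda>k. norm (fst (w (r k)))"]
        exI[of _ "\<lambda>k. (1 / norm (fst (w (r k)))) *\<^sub>R w (r k)"]) simp
  then have "1 \<le> M * norm v"
    using T uv(1) by fastforce
  also have "\<dots> \<le> M * (1 / M')"
    using uv(2) M(1) by (rule mult_left_mono)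
  also have "\<dots> < 1"
    using M by simp
  finally show False by simp
qed

text \<open>Common core of the next two lemmas, with \<open>c\<close> growing (\<open>l = 0\<close>)
  or constant (\<open>l = 1 / c\<close>). Failure of each eventual bound supplies graph points
  tending to \<open>z\<close> with violating tangent directions; tangent cones are closed under
  positive scaling, so the normalised directions remain tangent and their limit is an outer limiting
  one.\<close>

lemma outer_limiting_tangent_cone_limit_direction:
  fixes A :: "('a::euclidean_space \<times> 'b::euclidean_space) set"
  assumes not_ev: "\<And>k. \<not> (\<forall>\<^sub>F z' in inf (nhds z) (principal A).
      \<forall>(u, v) \<in> tangent_cone A z'. norm u \<le> c k * norm v)"
    and c: "\<And>k::nat. c k > 0" and lim_c: "(\<lambda>k. 1 / c k) \<longlonglongrightarrow> l"
  obtains u v where "(u, v) \<in> outer_limiting_tangent_cone A z" "norm u = 1" "norm v \<le> l"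
proof -
  have "\<exists>z' w. z' \<in> A \<and> dist z' z < 1 / real (Suc k) \<and> w \<in> tangent_cone A z' \<and>
      c k * norm (snd w) < norm (fst w)" for k
  proof (rule ccontr)
    assume "\<not> ?thesis"
    then have "\<forall>z'. dist z' z < 1 / real (Suc k) \<longrightarrow> z' \<in> A \<longrightarrow>
        (\<forall>(u, v) \<in> tangent_cone A z'. norm u \<le> c k * norm v)"
      by (fastforce simp: not_less)
    moreover have "1 / real (Suc k) > 0"
      by simp
    ultimately show False
      using not_ev[of k] unfolding eventually_inf_principal eventually_nhds_metric by blast
  qed
  then obtain z' w where z': "\<And>k. z' k \<in> A" "\<And>k. dist (z' k) z < 1 / real (Suc k)"
    and w: "\<And>k. w k \<in> tangent_cone A (z' k)" "\<And>k. c k * norm (snd (w k)) < norm (fst (w k))"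
    by metis
  have nz: "fst (w k) \<noteq> 0" for k
  proof
    assume "fst (w k) = 0"
    then show False
      using w(2)[of k] c[of k] by (simp add: mult_less_0_iff)
  qed
  have le: "norm (snd (w k)) \<le> 1 / c k * norm (fst (w k))" for k
    using w(2)[of k] c[of k] by (simp add: field_simps)
  obtain r u v where r: "strict_mono r"
    and lim: "(\<lambda>k. (1 / norm (fst (w (r k)))) *\<^sub>R w (r k)) \<longlonglongrightarrow> (u, v)"
    and uv: "norm u = 1" "norm v \<le> l"
    using normalized_convergent_subsequence[OF nz le lim_c] .
  have "(\<lambda>k. dist (z' k) z) \<longlonglongrightarrow> 0"
  proof (rule Lim_null_comparison)
    show "\<forall>\<^sub>F k in sequentially. norm (dist (z' k) z) \<le> inverse (real (Suc k))"
      using z'(2) by (auto intro!: always_eventually less_imp_le simp: inverse_eq_divide)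
  qed (rule LIMSEQ_inverse_real_of_nat)
  then have "z' \<longlonglongrightarrow> z"
    using tendsto_dist_iff by blast
  then have "(z' \<circ> r) \<longlonglongrightarrow> z"
    using LIMSEQ_subseq_LIMSEQ r by blast
  moreover have "\<forall>k. (z' \<circ> r) k \<in> A"
    using z'(1) by simp
  moreover have "\<forall>k. (1 / norm (fst (w (r k)))) *\<^sub>R w (r k) \<in> tangent_cone A ((z' \<circ> r) k)"
    using w(1) nz by (simp add: tangent_cone_scaleR)
  ultimately have "(u, v) \<in> outer_limiting_tangent_cone A z"
    using lim unfolding outer_limiting_tangent_cone_def
    by (intro CollectI exI[of _ "z' \<circ> r"]
        exI[of _ "\<lambda>k. (1 / norm (fst (w (r k)))) *\<^sub>R w (r k)"]) simp
  then show thesis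
    using that uv by blast
qed

text \<open>If all the moduli \<open>k + 1\<close> failed, the limit direction would have
  \<open>v = 0\<close> and \<open>norm u = 1\<close>, which the hypothesis excludes.\<close>

lemma eventually_tangent_bound:
  fixes A :: "('a::euclidean_space \<times> 'b::euclidean_space) set"
  assumes "\<And>u. (u, 0) \<in> outer_limiting_tangent_cone A z \<Longrightarrow> u = 0"
  obtains M :: real where "M > 0"
    "\<forall>\<^sub>F z' in inf (nhds z) (principal A). \<forall>(u, v) \<in> tangent_cone A z'. norm u \<le> M * norm v"
proof (rule ccontr)
  assume neg: "\<not> thesis"
  have not_ev: "\<not> (\<forall>\<^sub>F z' in inf (nhds z) (principal A).
      \<forall>(u, v) \<in> tangent_cone A z'. norm u \<le> real (Suc k) * norm v)" for k
    using neg that[of "real (Suc k)"] by auto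
  have "(\<lambda>k. 1 / real (Suc k)) \<longlonglongrightarrow> 0"
    using LIMSEQ_inverse_real_of_nat by (simp add: inverse_eq_divide)
  then obtain u v where "(u, v) \<in> outer_limiting_tangent_cone A z" "norm u = 1" "norm v \<le> 0"
    by (rule outer_limiting_tangent_cone_limit_direction[OF not_ev
          of_nat_0_less_iff[THEN iffD2, OF zero_less_Suc]])
  then show False
    using assms by fastforce
qed

text \<open>Quantitative version, behind the upper estimate of \<open>l_subreg\<close>: if
  \<open>M'\<close> failed, a limit direction would satisfy
  \<open>1 \<le> M * norm v \<le> M / M' < 1\<close>.\<close>

lemma eventually_tangent_bound_of_outer_bound:
  fixes A :: "('a::euclidean_space \<times> 'b::euclidean_space) set"
  assumes T: "\<And>u v. (u, v) \<in> outer_limiting_tangent_cone A z \<Longrightarrow> norm u \<le> M * norm v"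
    and M: "0 \<le> M" "M < M'"
  shows "\<forall>\<^sub>F z' in inf (nhds z) (principal A). \<forall>(u, v) \<in> tangent_cone A z'. norm u \<le> M' * norm v"
proof (rule ccontr)
  assume neg: "\<not> ?thesis"
  obtain u v where uv: "(u, v) \<in> outer_limiting_tangent_cone A z" "norm u = 1" "norm v \<le> 1 / M'"
    using outer_limiting_tangent_cone_limit_direction[where c = "\<lambda>_. M'", OF neg _ tendsto_const] M
    by auto
  have "1 \<le> M * norm v"
    using T uv(1,2) by fastforce
  also have "\<dots> \<le> M * (1 / M')"
    using uv(3) M(1) by (rule mult_left_mono)
  also have "\<dots> < 1"
    using M by simp
  finally show False by simp
qed

section \<open>Tangent bounds and strong subregularity at a single point\<close>

text \<open>The local estimate does double duty: with \<open>x\<close> as a candidate in the inverse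
  image of \<open>y\<close> it makes \<open>M'\<close> a subregularity constant, and for
  \<open>y' = y\<close> it forces \<open>x' = x\<close>, so \<open>x\<close> is isolated in that
  inverse image.\<close>

lemma strongly_subregular_of_tangent_bound:
  fixes F :: "'a::euclidean_space \<Rightarrow> 'b::euclidean_space set"
  assumes xy: "(x, y) \<in> gph F"
    and T: "\<And>u v. (u, v) \<in> tangent_cone (gph F) (x, y) \<Longrightarrow> norm u \<le> M * norm v"
    and M: "0 \<le> M" "M < M'"
  shows "strongly_metrically_subregular F x y" "subreg F x y \<le> ereal M'"
proof -
  obtain e where e: "e > 0"
    and le: "\<And>x' y'. y' \<in> F x' \<Longrightarrow> dist x' x < e \<Longrightarrow> dist x' x \<le> M' * dist y' y"
    using tangent_bound_imp_local_bound[OF T M] by (force simp: gph_def)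
  have y: "y \<in> F x"
    using xy by (simp add: gph_def)
  have "edist_set x' (set_inv F y) \<le> ereal M' * edist_set y (F x')" if "x' \<in> ball x e" for x'
  proof -
    have "edist_set x' (set_inv F y) \<le> ereal (dist x' x)"
      unfolding edist_set_def by (rule INF_lower) (simp add: set_inv_def y)
    also have "ereal (dist x' x) \<le> ereal M' * edist_set y (F x')"
    proof (cases "F x' = {}")
      \<comment> \<open>Here the distance to \<open>F x'\<close> is infinite, and
        \<open>M' > 0\<close> keeps the product infinite.\<close>
      case True
      then show ?thesis using M by (simp add: edist_set_def top_ereal_def)
    next
      case False
      \<comment> \<open>Dividing by \<open>M'\<close> leaves a bare infimum, which can be bounded
        below element by element.\<close>
      have "ereal (dist x' x) / ereal M' \<le> edist_set y (F x')"
        unfolding edist_set_def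
      proof (rule INF_greatest)
        fix s assume "s \<in> F x'"
        then have "dist x' x \<le> M' * dist y s"
          using le[of s x'] that by (simp add: dist_commute)
        then show "ereal (dist x' x) / ereal M' \<le> ereal (dist y s)"
          using M by (simp add: field_simps)
      qed
      then show ?thesis
        using M ereal_divide_le_pos[of "ereal M'" "ereal (dist x' x)"] by (simp del: ereal_divide)
    qed
    finally show ?thesis .
  qed
  then have const: "subreg_const F x y M'"
    unfolding subreg_const_def using M e by (auto intro!: exI[of _ "ball x e"])
  then show "subreg F x y \<le> ereal M'"
    unfolding subreg_def by (auto intro: INF_lower)
  have "set_inv F y \<inter> ball x e = {x}"
    using le[of y] y e by (fastforce simp: set_inv_def dist_commute)
  then show "strongly_metrically_subregular F x y"
    unfolding strongly_metrically_subregular_def metrically_subregular_def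
    using xy const e by (auto intro!: exI[of _ "ball x e"])
qed

text \<open>Since \<open>x\<close> is isolated in the inverse image of \<open>y\<close>, the
  distance to that set is the distance to \<open>x\<close> for points close to \<open>x\<close>.
  Along a tangent sequence the subregularity inequality thus becomes homogeneous in the step length,
  which cancels before the limit is taken.\<close>

lemma tangent_bound_of_subreg_less:
  fixes F :: "'a::real_normed_vector \<Rightarrow> 'b::real_normed_vector set"
  assumes strong: "strongly_metrically_subregular F x y"
    and less: "subreg F x y < ereal C"
    and uv: "(u, v) \<in> tangent_cone (gph F) (x, y)"
  shows "norm u \<le> C * norm v"
proof -
  obtain \<kappa> where \<kappa>: "subreg_const F x y \<kappa>" "\<kappa> < C"
    using less unfolding subreg_def INF_less_iff by auto
  then obtain X where X: "open X" "x \<in> X"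
    and sub: "\<And>x'. x' \<in> X \<Longrightarrow> edist_set x' (set_inv F y) \<le> ereal \<kappa> * edist_set y (F x')"
    and "\<kappa> \<ge> 0"
    unfolding subreg_const_def by blast
  obtain X' where X': "open X'" "x \<in> X'" "set_inv F y \<inter> X' = {x}"
    using strong unfolding strongly_metrically_subregular_def by blast
  obtain e where e: "e > 0" "ball x e \<subseteq> X'"
    using X' openE by blast
  obtain t w where t: "\<And>k. t k > 0" "t \<longlonglongrightarrow> 0" and w: "w \<longlonglongrightarrow> (u, v)"
    and gph: "\<And>k. (x, y) + t k *\<^sub>R w k \<in> gph F"
    using uv unfolding tangent_cone_def by blast
  have step: "norm (fst (w k)) \<le> \<kappa> * norm (snd (w k))"
    if k: "x + t k *\<^sub>R fst (w k) \<in> X \<inter> ball x (e/2)" for k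
  proof -
    let ?x = "x + t k *\<^sub>R fst (w k)" and ?y = "y + t k *\<^sub>R snd (w k)"
    have y: "?y \<in> F ?x"
      using gph[of k] by (simp add: gph_def split_beta)
    have "ereal (dist ?x x) \<le> edist_set ?x (set_inv F y)"
      unfolding edist_set_def
    proof (rule INF_greatest)
      fix s assume s: "s \<in> set_inv F y"
      show "ereal (dist ?x x) \<le> ereal (dist ?x s)"
      proof (cases "s = x")
        case False
        \<comment> \<open>Any other solution \<open>s\<close> is at distance at least
          \<open>e\<close> from \<open>x\<close>, hence more than \<open>e/2\<close> from
          \<open>?x\<close>, which lies within \<open>e/2\<close> of \<open>x\<close>; so
          \<open>x\<close> is the nearest solution.\<close>
        then have "dist x s \<ge> e"
          using s X'(3) e(2) by (metis IntI mem_ball not_le singletonD subsetD)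
        then show ?thesis
          using k dist_triangle[of x s ?x] by (simp add: dist_commute)
      qed simp
    qed
    also have "\<dots> \<le> ereal \<kappa> * edist_set y (F ?x)"
      using sub k by blast
    also have "\<dots> \<le> ereal \<kappa> * ereal (dist y ?y)"
      unfolding edist_set_def using \<open>\<kappa> \<ge> 0\<close> y
      by (intro ereal_mult_left_mono INF_lower) auto
    finally have "t k * norm (fst (w k)) \<le> t k * (\<kappa> * norm (snd (w k)))"
      using t(1)[of k] by (simp add: dist_norm ac_simps)
    then show ?thesis
      using t(1)[of k] by simp
  qed
  have "(\<lambda>k. x + t k *\<^sub>R fst (w k)) \<longlonglongrightarrow> x + 0 *\<^sub>R fst (u, v)"
    using t(2) w by (intro tendsto_intros)
  then have "(\<lambda>k. x + t k *\<^sub>R fst (w k)) \<longlonglongrightarrow> x"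
    by simp
  then have "\<forall>\<^sub>F k in sequentially. x + t k *\<^sub>R fst (w k) \<in> X \<inter> ball x (e/2)"
    using X e by (intro topological_tendstoD) auto
  then have "\<forall>\<^sub>F k in sequentially. norm (fst (w k)) \<le> \<kappa> * norm (snd (w k))"
    by (rule eventually_mono) (rule step)
  moreover have "(\<lambda>k. norm (fst (w k))) \<longlonglongrightarrow> norm (fst (u, v))"
    using w by (intro tendsto_intros)
  moreover have "(\<lambda>k. \<kappa> * norm (snd (w k))) \<longlonglongrightarrow> \<kappa> * norm (snd (u, v))"
    using w by (intro tendsto_intros)
  ultimately have "norm u \<le> \<kappa> * norm v"
    using tendsto_le[OF sequentially_bot] by fastforce
  also have "\<dots> \<le> C * norm v"
    using \<kappa>(2) by (simp add: mult_right_mono)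
  finally show ?thesis .
qed

section \<open>Passage to the upper limit around the reference point\<close>

text \<open>A strict bound on the upper limit makes the single constant \<open>C\<close> valid at
  all graph points near the reference point, so the pointwise tangent bounds along a defining
  sequence pass to the limit.\<close>

lemma outer_bound_of_l_subreg_less:
  fixes F :: "'a::real_normed_vector \<Rightarrow> 'b::real_normed_vector set"
  assumes strong: "strongly_metrically_subregular_around F x y"
    and less: "l_subreg F x y < ereal C"
    and uv: "(u, v) \<in> outer_limiting_tangent_cone (gph F) (x, y)"
  shows "norm u \<le> C * norm v"
proof -
  let ?A = "gph F"
  obtain W where W: "open W" "(x, y) \<in> W"
    "\<And>x' y'. (x', y') \<in> ?A \<inter> W \<Longrightarrow> strongly_metrically_subregular F x' y'"
    using strong unfolding strongly_metrically_subregular_around_def by fast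
  obtain z' w where z': "\<And>k. z' k \<in> ?A" "z' \<longlonglongrightarrow> (x, y)"
    and w: "\<And>k. w k \<in> tangent_cone ?A (z' k)" "w \<longlonglongrightarrow> (u, v)"
    using uv unfolding outer_limiting_tangent_cone_def by blast
  have "filterlim z' (inf (nhds (x, y)) (principal ?A)) sequentially"
    using z' by (simp add: filterlim_inf filterlim_principal)
  moreover have "\<forall>\<^sub>F z in inf (nhds (x, y)) (principal ?A). subreg F (fst z) (snd z) < ereal C"
    using less unfolding l_subreg_def case_prod_unfold by (rule Limsup_lessD)
  ultimately have "\<forall>\<^sub>F k in sequentially. subreg F (fst (z' k)) (snd (z' k)) < ereal C"
    unfolding filterlim_iff by blast
  moreover have "\<forall>\<^sub>F k in sequentially. z' k \<in> W"
    using z'(2) W by (intro topological_tendstoD) auto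
  ultimately have "\<forall>\<^sub>F k in sequentially. norm (fst (w k)) \<le> C * norm (snd (w k))"
  proof eventually_elim
    case (elim k)
    show ?case
      by (rule tangent_bound_of_subreg_less[OF _ elim(1)])
        (use W(3)[of "fst (z' k)" "snd (z' k)"] z'(1)[of k] elim(2) w(1)[of k] in auto)
  qed
  moreover have "(\<lambda>k. norm (fst (w k))) \<longlonglongrightarrow> norm (fst (u, v))"
    using w(2) by (intro tendsto_intros)
  moreover have "(\<lambda>k. C * norm (snd (w k))) \<longlonglongrightarrow> C * norm (snd (u, v))"
    using w(2) by (intro tendsto_intros)
  ultimately show ?thesis
    using tendsto_le[OF sequentially_bot] by fastforce
qed

lemma l_subreg_le_of_tangent_bound:
  fixes F :: "'a::euclidean_space \<Rightarrow> 'b::euclidean_space set"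
  assumes ev: "\<forall>\<^sub>F z in inf (nhds (x, y)) (principal (gph F)).
      \<forall>(u, v) \<in> tangent_cone (gph F) z. norm u \<le> M * norm v"
    and M: "0 \<le> M" "M < M'"
  shows "l_subreg F x y \<le> ereal M'"
proof -
  have "\<forall>\<^sub>F z in inf (nhds (x, y)) (principal (gph F)). z \<in> gph F"
    by (simp add: eventually_inf_principal)
  with ev have "\<forall>\<^sub>F z in inf (nhds (x, y)) (principal (gph F)). subreg F (fst z) (snd z) \<le> ereal M'"
  proof eventually_elim
    case (elim z)
    then show ?case
      using strongly_subregular_of_tangent_bound(2)[of "fst z" "snd z" F M M'] M by fastforce
  qed
  then show ?thesis
    unfolding l_subreg_def case_prod_unfold by (rule Limsup_bounded)
qed

lemma strongly_subregular_around_of_tangent_bound: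
  fixes F :: "'a::euclidean_space \<Rightarrow> 'b::euclidean_space set"
  assumes ev: "\<forall>\<^sub>F z in inf (nhds (x, y)) (principal (gph F)).
      \<forall>(u, v) \<in> tangent_cone (gph F) z. norm u \<le> M * norm v"
    and M: "0 \<le> M"
  shows "strongly_metrically_subregular_around F x y"
proof -
  obtain W where W: "open W" "(x, y) \<in> W"
    and T: "\<And>z. z \<in> W \<Longrightarrow> z \<in> gph F \<Longrightarrow>
      \<forall>(u, v) \<in> tangent_cone (gph F) z. norm u \<le> M * norm v"
    using ev unfolding eventually_inf_principal eventually_nhds by blast
  have "strongly_metrically_subregular F x' y'" if "(x', y') \<in> gph F \<inter> W" for x' y'
    using strongly_subregular_of_tangent_bound(1)[of x' y' F M "M + 1"] T[of "(x', y')"] that M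
    by auto
  moreover have "l_subreg F x y < \<infinity>"
    using l_subreg_le_of_tangent_bound[OF ev M, of "M + 1"] by (auto intro: le_less_trans)
  ultimately show ?thesis
    unfolding strongly_metrically_subregular_around_def using W by blast
qed

text \<open>Each \<open>subreg\<close> value is nonnegative, also when no constant exists.
  Membership in the graph makes the filter nontrivial; along the trivial filter the upper limit in
  \<open>ereal\<close> would be minus infinity.\<close>

lemma l_subreg_nonneg:
  assumes "(x, y) \<in> gph F"
  shows "0 \<le> l_subreg F x y"
  unfolding l_subreg_def
proof (rule le_Limsup)
  show "inf (nhds (x, y)) (principal (gph F)) \<noteq> bot"
  proof
    assume "inf (nhds (x, y)) (principal (gph F)) = bot"
    then have "\<forall>\<^sub>F z in nhds (x, y). z \<notin> gph F"
      using eventually_inf_principal[of "\<lambda>_. False" "nhds (x, y)" "gph F"] by simp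
    then show False
      using eventually_nhds_x_imp_x assms by blast
  qed
  show "\<forall>\<^sub>F z in inf (nhds (x, y)) (principal (gph F)). 0 \<le> (case z of (x', y') \<Rightarrow> subreg F x' y')"
    by (auto intro!: always_eventually INF_greatest simp: subreg_def subreg_const_def)
qed

section \<open>The kernel criterion and the formula for the modulus\<close>

theorem theorem6p1:
  fixes F :: "real ^ 'n \<Rightarrow> (real ^ 'n) set"
    and xbar ybar :: "real ^ 'n"
  assumes "(xbar, ybar) \<in> gph F"
    and "locally_closed_around (gph F) (xbar, ybar)"
  shows "(strongly_metrically_subregular_around F xbar ybar \<longleftrightarrow>
           (\<forall>u. 0 \<in> outer_limiting_graphical_derivative F xbar ybar u \<longrightarrow> u = 0)) \<and>
         (strongly_metrically_subregular_around F xbar ybar \<longrightarrow>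
           l_subreg F xbar ybar =
             Sup {ereal (norm u) | u v.
                    (u, v) \<in> gph (outer_limiting_graphical_derivative F xbar ybar) \<and> norm v \<le> 1})"
proof -
  let ?A = "gph F" and ?z = "(xbar, ybar)"
  let ?T = "outer_limiting_tangent_cone ?A ?z"
  let ?S = "{ereal (norm u) | u v.
      (u, v) \<in> gph (outer_limiting_graphical_derivative F xbar ybar) \<and> norm v \<le> 1}"
  have mem: "v \<in> outer_limiting_graphical_derivative F xbar ybar u \<longleftrightarrow> (u, v) \<in> ?T" for u v
    by (simp add: outer_limiting_graphical_derivative_def)
  have S: "?S = {ereal (norm u) | u v. (u, v) \<in> ?T \<and> norm v \<le> 1}"
    by (simp add: gph_def mem)
  have fwd: "u = 0"
    if strong: "strongly_metrically_subregular_around F xbar ybar" and u: "(u, 0) \<in> ?T" for u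
  proof -
    \<comment> \<open>Finiteness of \<open>l_subreg\<close> leaves room for a real \<open>C\<close>
      above it, and the resulting bound at \<open>v = 0\<close> reads
      \<open>norm u \<le> C * 0\<close>.\<close>
    obtain C :: real where "l_subreg F xbar ybar < ereal C"
      using strong ereal_dense2 unfolding strongly_metrically_subregular_around_def by blast
    from outer_bound_of_l_subreg_less[OF strong this u] show ?thesis by simp
  qed
  have bwd: "strongly_metrically_subregular_around F xbar ybar"
    if cond: "\<And>u. (u, 0) \<in> ?T \<Longrightarrow> u = 0"
  proof -
    obtain M where "M > 0" and ev: "\<forall>\<^sub>F z in inf (nhds ?z) (principal ?A).
        \<forall>(u, v) \<in> tangent_cone ?A z. norm u \<le> M * norm v"
      by (rule eventually_tangent_bound[OF cond])
    then show ?thesis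
      using strongly_subregular_around_of_tangent_bound[OF ev] by simp
  qed
  have "l_subreg F xbar ybar = Sup ?S"
    if strong: "strongly_metrically_subregular_around F xbar ybar"
  proof (rule antisym)
    show "Sup ?S \<le> l_subreg F xbar ybar"
    proof (rule ereal_le_real)
      fix C assume C: "l_subreg F xbar ybar \<le> ereal C"
      show "Sup ?S \<le> ereal C"
      proof (rule ereal_le_epsilon2)
        fix e :: real assume e: "e > 0"
        \<comment> \<open>The surplus \<open>e\<close> provides the strict inequality that the outer
          bound requires.\<close>
        then have less: "l_subreg F xbar ybar < ereal (C + e)"
          using C by (auto intro: le_less_trans)
        then have "C + e \<ge> 0"
          using l_subreg_nonneg[OF assms(1)] by (metis ereal_less_eq(5) less_imp_le order_trans)
        have "norm u \<le> C + e" if "(u, v) \<in> ?T" "norm v \<le> 1" for u v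
          using outer_bound_of_l_subreg_less[OF strong less that(1)]
            mult_left_mono[OF that(2) \<open>C + e \<ge> 0\<close>] by simp
        then show "Sup ?S \<le> ereal C + ereal e"
          unfolding S by (auto intro!: Sup_least)
      qed
    qed
    show "l_subreg F xbar ybar \<le> Sup ?S"
    \<comment> \<open>Comparing through real upper bounds \<open>M\<close> avoids a case split: an
      infinite supremum would have no such \<open>M\<close>.\<close>
    proof (rule ereal_le_real)
      fix M assume M: "Sup ?S \<le> ereal M"
      have le: "norm u \<le> M" if "(u, v) \<in> ?T" "norm v \<le> 1" for u v
      proof -
        have "ereal (norm u) \<le> Sup ?S"
          unfolding S using that by (intro Sup_upper) blast
        then show ?thesis
          using M order_trans by fastforce
      qed
      have "M \<ge> 0"
        using le[of 0 0] zero_in_outer_limiting_tangent_cone[OF assms(1)] by (simp add: zero_prod_def)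
      \<comment> \<open>The supremum only controls directions with \<open>norm v \<le> 1\<close>.
        Scaling to \<open>norm v = 1\<close> extends the bound to all nonzero \<open>v\<close>;
        \<open>v = 0\<close> cannot be rescaled and is settled by the kernel condition.\<close>
      have bound: "norm u \<le> M * norm v" if uv: "(u, v) \<in> ?T" for u v
      proof (cases "v = 0")
        case True
        then show ?thesis using fwd[OF strong] uv by simp
      next
        case False
        then have "(1 / norm v) *\<^sub>R (u, v) \<in> ?T"
          using outer_limiting_tangent_cone_scaleR[OF uv] by simp
        then show ?thesis
          using le[of "(1 / norm v) *\<^sub>R u" "(1 / norm v) *\<^sub>R v"] False by (simp add: field_simps)
      qed
      show "l_subreg F xbar ybar \<le> ereal M"
      proof (rule ereal_le_epsilon2)
        fix e :: real assume e: "e > 0"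
        \<comment> \<open>Two strict enlargements share \<open>e\<close>: from outer limiting to
          nearby tangent cones (\<open>M\<close> to \<open>M + e/2\<close>), then from tangent cones
          to \<open>subreg\<close> (\<open>M + e/2\<close> to \<open>M + e\<close>).\<close>
        then have ev: "\<forall>\<^sub>F z in inf (nhds ?z) (principal ?A).
            \<forall>(u, v) \<in> tangent_cone ?A z. norm u \<le> (M + e/2) * norm v"
          using bound \<open>M \<ge> 0\<close> by (intro eventually_tangent_bound_of_outer_bound[where M = M]) auto
        show "l_subreg F xbar ybar \<le> ereal M + ereal e"
          using l_subreg_le_of_tangent_bound[OF ev, of "M + e"] e \<open>M \<ge> 0\<close> by simp
      qed
    qed
  qed
  then show ?thesis
    using fwd bwd by (auto simp: mem)
qed

end
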